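(* Let $G$ be a finite group and let $\mu,\nu,\tau\in\Lambda_G$. The generating functions $h^{\tau}_{\mu,\nu}(\beta)=\sum_{r}h_\tau(\mu,\nu;r)\,\beta^r$ for the numbers $h_\tau(\mu,\nu;r)$ satisfy the equation $$h^{\tau}_{\mu,\nu}(\beta)+\beta\frac{\partial}{\partial\beta}h^{\tau}_{\mu,\nu}(\beta)=(\#G)\sum_{\lambda\in\Lambda_G}\frac{h^{\tau}_{\mu,\lambda}(\beta)\,h^{\tau}_{\lambda,\nu}(\beta)}{\mathrm{tr}(f_{\lambda^{-1}}f_\lambda)}.$$
   Context: $G$ is a finite group, $\Lambda_G$ is its set of conjugacy classes, and $\mu^{-1}$ denotes the conjugacy class of the inverses of the elements of $\mu$. $Z\mathbb C[G]$ is the center of the complex group algebra (complex-valued functions on $G$ under convolution), with standard basis $\{f_\mu\}_{\mu\in\Lambda_G}$, where $f_\mu$ is the characteristic function of $\mu\subset G$. The trace $\mathrm{tr}\colon Z\mathbb C[G]\to\mathbb C$ is the linear functional with $\mathrm{tr}(f_\mu)=1$ if $\mu=(1)$ is the class of the unit element and $\mathrm{tr}(f_\mu)=0$ otherwise. For $r+2$ fixed points $q_0,\dots,q_{r+1}$ on $\mathbb CP^1$, $h_\tau(\mu,\nu;r)$ is the weighted number of principal $G$-bundles over $\mathbb CP^1$ with a non-trivial holonomy around $q_0,\dots,q_{r+1}$, such that the holonomy around $q_0$ is in $\mu$, the holonomy around $q_{r+1}$ is in $\nu$, and the holonomy around each of the other points $q_1,\dots,q_r$ is in the fixed class $\tau$.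 Bundles are counted up to equivalence, each with weight the reciprocal of the order of its automorphism group. This number is computed as the number of homomorphisms from the fundamental group of the $(r+2)$-times punctured sphere to $G$ such that the image of the element corresponding to a complete revolution around each $q_i$ lies in the conjugacy class prescribed at $q_i$, divided by $\#G$.
   Formalization: The revolution around q_{r+1} is taken in the opposite sense to the others (relation c_0…c_r = c_{r+1}); with all revolutions in the same sense the printed equation fails, e.g. G = Z/3, τ = (1), μ = ν = {g}. *)

theory Defs
  imports
    Complex_Main
    "HOL-Algebra.Group_Action"
    "HOL-Computational_Algebra.Formal_Power_Series"
begin

section \<open>Conjugacy classes, the class algebra and its trace\<close>

definition conj_classes :: "('a, 'm) monoid_scheme \<Rightarrow> 'a set set" where
  "conj_classes G =
     orbits G (carrier G) (\<lambda>g. \<lambda>h \<in> carrier G. g \<otimes>\<^bsub>G\<^esub> h \<otimes>\<^bsub>G\<^esub> inv\<^bsub>G\<^esub> g)"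

definition class_fun :: "'a set \<Rightarrow> 'a \<Rightarrow> complex" where
  "class_fun \<mu> = (\<lambda>x. of_bool (x \<in> \<mu>))"

definition convol ::
  "('a, 'm) monoid_scheme \<Rightarrow> ('a \<Rightarrow> complex) \<Rightarrow> ('a \<Rightarrow> complex) \<Rightarrow> 'a \<Rightarrow> complex" where
  "convol G f g =
     (\<lambda>x. if x \<in> carrier G
          then \<Sum>y\<in>carrier G. f y * g (inv\<^bsub>G\<^esub> y \<otimes>\<^bsub>G\<^esub> x) else 0)"

text \<open>A class function is the combination of the characteristic functions of the conjugacy
  classes whose coefficients are its values, so the linear functional that is 1 on the class of
  the unit and 0 on all other classes is evaluation at the unit;
  see \<open>class_trace_class_fun\<close> and \<open>class_trace_linear\<close>.\<close>

definition class_trace :: "('a, 'm) monoid_scheme \<Rightarrow> ('a \<Rightarrow> complex) \<Rightarrow> complex" where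
  "class_trace G f = f \<one>\<^bsub>G\<^esub>"

lemma class_trace_linear:
  "class_trace G (\<lambda>x. a * f x + b * g x) = a * class_trace G f + b * class_trace G g"
  by (simp add: class_trace_def)

lemma class_trace_class_fun:
  assumes "group G" and "\<mu> \<in> conj_classes G"
  shows "class_trace G (class_fun \<mu>) = (if \<mu> = {\<one>\<^bsub>G\<^esub>} then 1 else 0)"
proof -
  interpret group G by fact
  obtain x where x: "x \<in> carrier G"
    and mu: "\<mu> = {g \<otimes>\<^bsub>G\<^esub> x \<otimes>\<^bsub>G\<^esub> inv\<^bsub>G\<^esub> g | g. g \<in> carrier G}"
    using assms(2) by (auto simp: conj_classes_def orbits_def orbit_def)
  have "\<mu> = {\<one>\<^bsub>G\<^esub>}" if one: "\<one>\<^bsub>G\<^esub> \<in> \<mu>"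
  proof -
    obtain g where g: "g \<in> carrier G" and "g \<otimes>\<^bsub>G\<^esub> x \<otimes>\<^bsub>G\<^esub> inv\<^bsub>G\<^esub> g = \<one>\<^bsub>G\<^esub>"
      using one mu by force
    then have "g \<otimes>\<^bsub>G\<^esub> x = g"
      using x by (metis inv_closed inv_equality inv_inv m_closed)
    then have "x = \<one>\<^bsub>G\<^esub>"
      using x g by simp
    then show ?thesis
      unfolding mu by (auto intro!: exI[of _ "\<one>\<^bsub>G\<^esub>"])
  qed
  then have "\<one>\<^bsub>G\<^esub> \<in> \<mu> \<longleftrightarrow> \<mu> = {\<one>\<^bsub>G\<^esub>}"
    by blast
  then show ?thesis
    by (simp only: class_trace_def class_fun_def of_bool_def)
qed


section \<open>The fundamental group of the punctured sphere\<close>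

text \<open>
  Put \<open>q\<^sub>r\<^sub>+\<^sub>1\<close> at infinity.  The generator \<open>c\<^sub>i\<close> is a loop making one complete revolution around
  \<open>q\<^sub>i\<close>; for all \<open>i \<le> r + 1\<close>, the revolution is counterclockwise as seen in the affine chart
  \<open>\<complex> = \<complex>P\<^sup>1 - {q\<^sub>r\<^sub>+\<^sub>1}\<close>.  Thus \<open>c\<^sub>r\<^sub>+\<^sub>1\<close> is the big circle enclosing all finite punctures, and the
  fundamental group is generated by \<open>c\<^sub>0, \<dots>, c\<^sub>r\<^sub>+\<^sub>1\<close> with the single relation
  \<open>c\<^sub>0 c\<^sub>1 \<dots> c\<^sub>r = c\<^sub>r\<^sub>+\<^sub>1\<close>.

  The orientation at \<open>q\<^sub>r\<^sub>+\<^sub>1\<close> matters.  If it were reversed (relation \<open>c\<^sub>0 c\<^sub>1 \<dots> c\<^sub>r\<^sub>+\<^sub>1 = 1\<close>), then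
  the class \<open>\<nu>\<close> prescribed at \<open>q\<^sub>r\<^sub>+\<^sub>1\<close> would have to be replaced by its inverse.  Cutting the
  sphere into two spheres along a circle with holonomy in \<open>\<lambda>\<close> gives the same class \<open>\<lambda>\<close> at
  \<open>q\<^sub>r\<^sub>+\<^sub>1\<close> of the first piece and at \<open>q\<^sub>0\<close> of the second for the orientation chosen here, but
  mutually inverse classes for the reversed one.  For example, with the reversed one the numbers
  for the group of order 3, \<open>\<tau>\<close> trivial and \<open>\<mu> = \<nu>\<close> not trivial vanish for all \<open>r\<close>, while
  products of the numbers for \<open>(\<mu>, \<mu>\<^sup>-\<^sup>1)\<close> and for \<open>(\<mu>\<^sup>-\<^sup>1, \<mu>)\<close> do not.

  The group is constructed as words in the letters \<open>(i, True)\<close>, standing for \<open>c\<^sub>i\<close>, and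
  \<open>(i, False)\<close>, standing for its inverse, modulo the congruence generated by the relations.
\<close>

type_synonym loop_word = "(nat \<times> bool) list"

definition loop_words :: "nat \<Rightarrow> loop_word set" where
  "loop_words r = lists ({..r + 1} \<times> UNIV)"

inductive loop_eq :: "nat \<Rightarrow> loop_word \<Rightarrow> loop_word \<Rightarrow> bool" for r :: nat where
  refl: "w \<in> loop_words r \<Longrightarrow> loop_eq r w w"
| sym: "loop_eq r w w' \<Longrightarrow> loop_eq r w' w"
| trans: "loop_eq r w w' \<Longrightarrow> loop_eq r w' w'' \<Longrightarrow> loop_eq r w w''"
| cancel: "u \<in> loop_words r \<Longrightarrow> v \<in> loop_words r \<Longrightarrow> i \<le> r + 1 \<Longrightarrow>
    loop_eq r (u @ [(i, b), (i, \<not> b)] @ v) (u @ v)"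
| boundary: "u \<in> loop_words r \<Longrightarrow> v \<in> loop_words r \<Longrightarrow>
    loop_eq r (u @ map (\<lambda>i. (i, True)) [0..<r + 1] @ v) (u @ [(r + 1, True)] @ v)"

definition loop_rel :: "nat \<Rightarrow> (loop_word \<times> loop_word) set" where
  "loop_rel r = {(w, w'). loop_eq r w w'}"

definition sphere_group :: "nat \<Rightarrow> loop_word set monoid" where
  "sphere_group r =
     \<lparr>carrier = loop_words r // loop_rel r,
      monoid.mult = (\<lambda>X Y. \<Union>x\<in>X. \<Union>y\<in>Y. loop_rel r `` {x @ y}),
      one = loop_rel r `` {[]}\<rparr>"

definition puncture_loop :: "nat \<Rightarrow> nat \<Rightarrow> loop_word set" where
  "puncture_loop r i = loop_rel r `` {[(i, True)]}"


section \<open>The weighted numbers of bundles and their generating functions\<close>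

definition puncture_class :: "'a set \<Rightarrow> 'a set \<Rightarrow> 'a set \<Rightarrow> nat \<Rightarrow> nat \<Rightarrow> 'a set" where
  "puncture_class \<tau> \<mu> \<nu> r i = (if i = 0 then \<mu> else if i = r + 1 then \<nu> else \<tau>)"

text \<open>Bundles on the punctured sphere up to equivalence are homomorphisms from the fundamental
  group to \<open>G\<close> up to conjugation, and the automorphism group of a bundle is the stabilizer of the
  homomorphism.  Hence the count with weights \<open>1 / #Aut\<close> is the number of homomorphisms divided
  by \<open>#G\<close>.  Any of the prescribed classes may be the class of the unit.

  Elements of \<^const>\<open>hom\<close> are unconstrained outside the carrier of the source; intersecting
  with \<^const>\<open>extensional\<close> makes each homomorphism count once.\<close>

definition bundle_homs ::
  "('a, 'm) monoid_scheme \<Rightarrow> 'a set \<Rightarrow> 'a set \<Rightarrow> 'a set \<Rightarrow> nat \<Rightarrow> (loop_word set \<Rightarrow> 'a) set" where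
  "bundle_homs G \<tau> \<mu> \<nu> r =
     {\<phi> \<in> hom (sphere_group r) G \<inter> extensional (carrier (sphere_group r)).
        \<forall>i\<le>r + 1. \<phi> (puncture_loop r i) \<in> puncture_class \<tau> \<mu> \<nu> r i}"

definition bundle_number ::
  "('a, 'm) monoid_scheme \<Rightarrow> 'a set \<Rightarrow> 'a set \<Rightarrow> 'a set \<Rightarrow> nat \<Rightarrow> complex" where
  "bundle_number G \<tau> \<mu> \<nu> r = of_nat (card (bundle_homs G \<tau> \<mu> \<nu> r)) / of_nat (order G)"

definition bundle_gf ::
  "('a, 'm) monoid_scheme \<Rightarrow> 'a set \<Rightarrow> 'a set \<Rightarrow> 'a set \<Rightarrow> complex fps" where
  "bundle_gf G \<tau> \<mu> \<nu> = Abs_fps (\<lambda>r. bundle_number G \<tau> \<mu> \<nu> r)"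


section \<open>Basic properties of the presented group\<close>

lemma loop_words_simps [simp]:
  "[] \<in> loop_words r"
  "x # w \<in> loop_words r \<longleftrightarrow> fst x \<le> r + 1 \<and> w \<in> loop_words r"
  "v @ w \<in> loop_words r \<longleftrightarrow> v \<in> loop_words r \<and> w \<in> loop_words r"
  by (cases x; auto simp: loop_words_def)+

lemma loop_words_boundary [simp]: "map (\<lambda>i. (i, True)) [0..<r + 1] \<in> loop_words r"
  by (auto simp: loop_words_def)

lemma loop_eq_words: "loop_eq r w w' \<Longrightarrow> w \<in> loop_words r \<and> w' \<in> loop_words r"
  by (induction rule: loop_eq.induct)
     (use loop_words_boundary in \<open>simp_all del: upt_Suc add: Suc_eq_plus1[symmetric]\<close>)

lemma loop_eq_append_right:
  "loop_eq r w w' \<Longrightarrow> z \<in> loop_words r \<Longrightarrow> loop_eq r (w @ z) (w' @ z)"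
proof (induction rule: loop_eq.induct)
  case (cancel u v i b)
  then show ?case using loop_eq.cancel[of u r "v @ z" i b] by simp
next
  case (boundary u v)
  then show ?case using loop_eq.boundary[of u r "v @ z"] by simp
qed (auto intro: loop_eq.refl loop_eq.sym loop_eq.trans)

lemma loop_eq_append_left:
  "loop_eq r w w' \<Longrightarrow> z \<in> loop_words r \<Longrightarrow> loop_eq r (z @ w) (z @ w')"
proof (induction rule: loop_eq.induct)
  case (cancel u v i b)
  then show ?case using loop_eq.cancel[of "z @ u" r v i b] by simp
next
  case (boundary u v)
  then show ?case using loop_eq.boundary[of "z @ u" r v] by simp
qed (auto intro: loop_eq.refl loop_eq.sym loop_eq.trans)

lemma loop_eq_append:
  "loop_eq r v v' \<Longrightarrow> loop_eq r w w' \<Longrightarrow> loop_eq r (v @ w) (v' @ w')"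
  by (meson loop_eq.trans loop_eq_append_left loop_eq_append_right loop_eq_words)

lemma equiv_loop_rel: "equiv (loop_words r) (loop_rel r)"
  by (rule equivI)
     (auto simp: loop_rel_def refl_on_def sym_def trans_def dest: loop_eq_words
       intro: loop_eq.refl loop_eq.sym loop_eq.trans)

lemma loop_class_eq:
  "loop_eq r v w \<Longrightarrow> loop_rel r `` {v} = loop_rel r `` {w}"
  by (rule equiv_class_eq[OF equiv_loop_rel]) (simp add: loop_rel_def)

lemma sphere_group_mult:
  assumes "v \<in> loop_words r" "w \<in> loop_words r"
  shows "loop_rel r `` {v} \<otimes>\<^bsub>sphere_group r\<^esub> loop_rel r `` {w} = loop_rel r `` {v @ w}"
proof -
  have "congruent2 (loop_rel r) (loop_rel r) (\<lambda>x y. loop_rel r `` {x @ y})"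
    unfolding congruent2_def
    by (clarsimp, rule loop_class_eq, rule loop_eq_append) (simp_all add: loop_rel_def)
  then show ?thesis
    using UN_equiv_class2[OF equiv_loop_rel equiv_loop_rel] assms
    by (simp add: sphere_group_def)
qed

lemma sphere_group_carrier:
  "carrier (sphere_group r) = (\<lambda>w. loop_rel r `` {w}) ` loop_words r"
  by (auto simp: sphere_group_def quotient_def)

lemma sphere_group_one: "\<one>\<^bsub>sphere_group r\<^esub> = loop_rel r `` {[]}"
  by (simp add: sphere_group_def)

lemma loop_word_inverse:
  "w \<in> loop_words r \<Longrightarrow> \<exists>v \<in> loop_words r. loop_eq r (v @ w) []"
proof (induction w)
  case Nil
  then show ?case by (auto intro!: bexI[of _ "[]"] loop_eq.refl)
next
  case (Cons x w)
  obtain i b where x: "x = (i, b)" by force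
  obtain v where v: "v \<in> loop_words r" "loop_eq r (v @ w) []"
    using Cons by auto
  have "loop_eq r ((v @ [(i, \<not> b)]) @ x # w) (v @ w)"
    using loop_eq.cancel[of v r w i "\<not> b"] Cons v x by simp
  then show ?case
    using v Cons x by (intro bexI[of _ "v @ [(i, \<not> b)]"]) (auto intro: loop_eq.trans)
qed

lemma group_sphere_group: "group (sphere_group r)"
proof (rule groupI)
  fix X assume "X \<in> carrier (sphere_group r)"
  then obtain w where w: "w \<in> loop_words r" "X = loop_rel r `` {w}"
    by (auto simp: sphere_group_carrier)
  then obtain v where "v \<in> loop_words r" "loop_eq r (v @ w) []"
    using loop_word_inverse by blast
  then show "\<exists>Y\<in>carrier (sphere_group r). Y \<otimes>\<^bsub>sphere_group r\<^esub> X = \<one>\<^bsub>sphere_group r\<^esub>"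
    using w by (intro bexI[of _ "loop_rel r `` {v}"])
      (auto simp: sphere_group_mult sphere_group_one sphere_group_carrier loop_class_eq)
qed (auto simp: sphere_group_carrier sphere_group_one sphere_group_mult)

lemma puncture_loop_closed: "i \<le> r + 1 \<Longrightarrow> puncture_loop r i \<in> carrier (sphere_group r)"
  by (auto simp: puncture_loop_def sphere_group_carrier)

definition word_value :: "('a, 'm) monoid_scheme \<Rightarrow> (nat \<Rightarrow> 'a) \<Rightarrow> loop_word \<Rightarrow> 'a" where
  "word_value G g w =
     foldr (\<lambda>(i, b) x. (if b then g i else inv\<^bsub>G\<^esub> g i) \<otimes>\<^bsub>G\<^esub> x) w \<one>\<^bsub>G\<^esub>"

context
  fixes G :: "('a, 'm) monoid_scheme" and r :: nat and g :: "nat \<Rightarrow> 'a"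
  assumes G: "group G" and g: "\<And>i. i \<le> r + 1 \<Longrightarrow> g i \<in> carrier G"
begin

lemma word_value_closed: "w \<in> loop_words r \<Longrightarrow> word_value G g w \<in> carrier G"
proof (induction w)
  case Nil
  then show ?case using G by (simp add: word_value_def group.is_monoid)
next
  case (Cons x w)
  interpret group G by (fact G)
  show ?case using Cons g by (cases x) (auto simp: word_value_def)
qed

lemma word_value_append:
  "v \<in> loop_words r \<Longrightarrow> w \<in> loop_words r \<Longrightarrow>
   word_value G g (v @ w) = word_value G g v \<otimes>\<^bsub>G\<^esub> word_value G g w"
proof (induction v)
  case Nil
  then show ?case using word_value_closed G
    by (simp add: word_value_def group.is_monoid)
next
  case (Cons x v)
  interpret group G by (fact G)
  show ?case using Cons g word_value_closed
    by (cases x) (auto simp: word_value_def m_assoc)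
qed

lemma word_value_loop_eq:
  assumes rel: "foldr (\<lambda>i x. g i \<otimes>\<^bsub>G\<^esub> x) [0..<r + 1] \<one>\<^bsub>G\<^esub> = g (r + 1)"
  shows "loop_eq r w w' \<Longrightarrow> word_value G g w = word_value G g w'"
proof (induction rule: loop_eq.induct)
  case (cancel u v i b)
  interpret group G by (fact G)
  have "word_value G g ([(i, b), (i, \<not> b)] @ v) = word_value G g v"
    using cancel g[of i] word_value_closed[of v]
    by (cases b) (simp_all add: word_value_def m_assoc[symmetric])
  then show ?case using cancel by (simp add: word_value_append)
next
  case (boundary u v)
  interpret group G by (fact G)
  have "word_value G g (map (\<lambda>i. (i, True)) [0..<r + 1]) = word_value G g [(r + 1, True)]"
    using rel g[of "r + 1"] by (simp del: upt_Suc add: word_value_def foldr_map comp_def)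
  then have "word_value G g (map (\<lambda>i. (i, True)) [0..<r + 1] @ v)
      = word_value G g ([(r + 1, True)] @ v)"
    using boundary word_value_append[OF loop_words_boundary, of v]
      word_value_append[of "[(r + 1, True)]" v] by simp
  moreover have "map (\<lambda>i. (i, True)) [0..<r + 1] @ v \<in> loop_words r"
    using boundary loop_words_boundary by (simp only: loop_words_simps)
  ultimately show ?case
    using boundary word_value_append[of u] by simp
qed auto

text \<open>The universal property of the presentation: homomorphisms from the fundamental group are
  the same as families satisfying the relation.\<close>

lemma sphere_group_hom_exists:
  assumes rel: "foldr (\<lambda>i x. g i \<otimes>\<^bsub>G\<^esub> x) [0..<r + 1] \<one>\<^bsub>G\<^esub> = g (r + 1)"
  shows "\<exists>\<phi> \<in> hom (sphere_group r) G \<inter> extensional (carrier (sphere_group r)).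
    \<forall>i\<le>r + 1. \<phi> (puncture_loop r i) = g i"
proof -
  interpret group G by (fact G)
  let ?P = "sphere_group r"
  define \<phi> where "\<phi> = (\<lambda>X \<in> carrier ?P. word_value G g (SOME w. w \<in> X))"
  have val: "\<phi> (loop_rel r `` {w}) = word_value G g w" if "w \<in> loop_words r" for w
  proof -
    have "loop_eq r w (SOME v. v \<in> loop_rel r `` {w})"
      using someI[of "\<lambda>v. v \<in> loop_rel r `` {w}" w] loop_eq.refl[OF that]
      by (simp add: loop_rel_def)
    then show ?thesis
      using word_value_loop_eq[OF rel] that
      by (simp add: \<phi>_def sphere_group_carrier)
  qed
  have "\<phi> \<in> hom ?P G"
    by (rule homI)
      (auto simp: sphere_group_carrier val word_value_closed sphere_group_mult word_value_append)
  moreover have "\<phi> (puncture_loop r i) = g i" if "i \<le> r + 1" for i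
    using that g[of i] by (simp add: puncture_loop_def val word_value_def)
  moreover have "\<phi> \<in> extensional (carrier ?P)"
    by (simp add: \<phi>_def)
  ultimately show ?thesis by blast
qed

end

lemma sphere_group_hom_value:
  assumes "group G" and \<phi>: "\<phi> \<in> hom (sphere_group r) G"
  shows "w \<in> loop_words r \<Longrightarrow>
    \<phi> (loop_rel r `` {w}) = word_value G (\<lambda>i. \<phi> (puncture_loop r i)) w"
proof (induction w)
  case Nil
  interpret group_hom "sphere_group r" G \<phi>
    using assms group_sphere_group by (simp add: group_hom_def group_hom_axioms_def)
  show ?case using hom_one by (simp add: word_value_def sphere_group_one)
next
  case (Cons x w)
  interpret group_hom "sphere_group r" G \<phi>
    using assms group_sphere_group by (simp add: group_hom_def group_hom_axioms_def)
  obtain i b where x: "x = (i, b)" by force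
  have i: "i \<le> r + 1" and w: "w \<in> loop_words r" using Cons x by auto
  have "loop_rel r `` {[(i, False)]} \<otimes>\<^bsub>sphere_group r\<^esub> puncture_loop r i = \<one>\<^bsub>sphere_group r\<^esub>"
    using i loop_class_eq[OF loop_eq.cancel[of "[]" r "[]" i False]]
    by (simp add: puncture_loop_def sphere_group_mult sphere_group_one)
  then have "inv\<^bsub>sphere_group r\<^esub> (puncture_loop r i) = loop_rel r `` {[(i, False)]}"
    using i puncture_loop_closed[OF i] by (intro G.inv_equality) (auto simp: sphere_group_carrier)
  then have inv: "\<phi> (loop_rel r `` {[(i, False)]}) = inv\<^bsub>G\<^esub> \<phi> (puncture_loop r i)"
    using hom_inv[OF puncture_loop_closed[OF i]] by simp
  have "loop_rel r `` {x # w} = loop_rel r `` {[x]} \<otimes>\<^bsub>sphere_group r\<^esub> loop_rel r `` {w}"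
    using i w x by (simp add: sphere_group_mult)
  then have "\<phi> (loop_rel r `` {x # w}) = \<phi> (loop_rel r `` {[x]}) \<otimes>\<^bsub>G\<^esub> \<phi> (loop_rel r `` {w})"
    using i w x by (simp add: sphere_group_carrier)
  then show ?case
    using Cons.IH[OF w] inv x by (cases b) (simp_all add: word_value_def puncture_loop_def)
qed

lemma sphere_group_hom_relation:
  assumes "group G" and \<phi>: "\<phi> \<in> hom (sphere_group r) G"
  shows "foldr (\<lambda>i x. \<phi> (puncture_loop r i) \<otimes>\<^bsub>G\<^esub> x) [0..<r + 1] \<one>\<^bsub>G\<^esub>
    = \<phi> (puncture_loop r (r + 1))"
proof -
  have "loop_rel r `` {map (\<lambda>i. (i, True)) [0..<r + 1]} = puncture_loop r (r + 1)"
    using loop_class_eq[OF loop_eq.boundary[of "[]" r "[]"]]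
    by (simp del: upt_Suc add: puncture_loop_def)
  then show ?thesis
    using sphere_group_hom_value[OF assms loop_words_boundary]
    by (simp del: upt_Suc add: word_value_def foldr_map comp_def)
qed

lemma sphere_group_hom_unique:
  assumes "group G"
    and "\<phi> \<in> hom (sphere_group r) G \<inter> extensional (carrier (sphere_group r))"
    and "\<psi> \<in> hom (sphere_group r) G \<inter> extensional (carrier (sphere_group r))"
    and eq: "\<And>i. i \<le> r + 1 \<Longrightarrow> \<phi> (puncture_loop r i) = \<psi> (puncture_loop r i)"
  shows "\<phi> = \<psi>"
proof (rule extensionalityI[of _ "carrier (sphere_group r)"])
  have "word_value G (\<lambda>i. \<phi> (puncture_loop r i)) w = word_value G (\<lambda>i. \<psi> (puncture_loop r i)) w"
    if "w \<in> loop_words r" for w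
    using that by (induction w) (use eq in \<open>auto simp: word_value_def\<close>)
  then show "\<phi> X = \<psi> X" if "X \<in> carrier (sphere_group r)" for X
    using that assms(2,3) sphere_group_hom_value[OF assms(1)]
    by (fastforce simp: sphere_group_carrier)
qed (use assms(2,3) in blast)+

end

theory Submission
  imports Defs
begin

text \<open>A homomorphism from the fundamental group of the punctured sphere amounts to a walk in \<open>G\<close>
  that starts in \<open>\<mu>\<close>, multiplies on the right by an element of \<open>\<tau>\<close> in each of \<open>r\<close> steps and ends
  in \<open>\<nu>\<close>.  Cutting such a walk after \<open>k\<close> steps, at a point of the class \<open>\<lambda>\<close>, and using that the
  number of ways to continue depends on that class only, gives
  \<open>N\<^sub>r(\<mu>, \<nu>) = \<Sum>\<^sub>\<lambda> N\<^sub>k(\<mu>, \<lambda>) N\<^sub>r\<^sub>-\<^sub>k(\<lambda>, \<nu>) / #\<lambda>\<close> for the numbers \<open>N\<^sub>r = #G h\<^sub>\<tau>\<close> of homomorphisms.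
  The theorem is the sum of these identities over the \<open>r + 1\<close> possible values of \<open>k\<close>,
  because the trace in the denominator is \<open>#\<lambda>\<close>.\<close>

section \<open>Walks and their recursion\<close>

definition walks :: "('a, 'm) monoid_scheme \<Rightarrow> 'a set \<Rightarrow> nat \<Rightarrow> 'a set \<Rightarrow> 'a \<Rightarrow> 'a list set" where
  "walks G \<tau> r \<nu> a =
     {ts. length ts = r \<and> set ts \<subseteq> \<tau> \<and> a \<otimes>\<^bsub>G\<^esub> foldr (\<otimes>\<^bsub>G\<^esub>) ts \<one>\<^bsub>G\<^esub> \<in> \<nu>}"

lemma finite_walks: "finite \<tau> \<Longrightarrow> finite (walks G \<tau> r \<nu> a)"
  by (rule finite_subset[OF _ finite_lists_length_eq[of \<tau> r]]) (auto simp: walks_def)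

context group
begin

lemma foldr_mult_closed: "set ts \<subseteq> carrier G \<Longrightarrow> foldr (\<otimes>) ts \<one> \<in> carrier G"
  by (induction ts) auto

lemma card_walks_0: "a \<in> carrier G \<Longrightarrow> card (walks G \<tau> 0 \<nu> a) = of_bool (a \<in> \<nu>)"
proof -
  assume "a \<in> carrier G"
  then have "walks G \<tau> 0 \<nu> a = (if a \<in> \<nu> then {[]} else {})"
    by (auto simp: walks_def)
  then show ?thesis by simp
qed

text \<open>The first step \<open>t\<close> is absorbed into the starting point. This recursion
  drives the inductions on the number of steps.\<close>

lemma card_walks_Suc:
  assumes a: "a \<in> carrier G" and \<tau>: "finite \<tau>" "\<tau> \<subseteq> carrier G"
  shows "card (walks G \<tau> (Suc r) \<nu> a) = (\<Sum>t\<in>\<tau>. card (walks G \<tau> r \<nu> (a \<otimes> t)))"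
proof -
  have assoc: "a \<otimes> (t \<otimes> foldr (\<otimes>) ts \<one>) = a \<otimes> t \<otimes> foldr (\<otimes>) ts \<one>"
    if "t \<in> \<tau>" "set ts \<subseteq> \<tau>" for t ts
    using that a \<tau> foldr_mult_closed[of ts] by (subst m_assoc) auto
  have "walks G \<tau> (Suc r) \<nu> a = (\<lambda>(t, ts). t # ts) ` (SIGMA t:\<tau>. walks G \<tau> r \<nu> (a \<otimes> t))"
    by (force simp: walks_def image_iff length_Suc_conv assoc)
  moreover have "inj_on (\<lambda>(t, ts). t # ts) (SIGMA t:\<tau>. walks G \<tau> r \<nu> (a \<otimes> t))"
    by (auto simp: inj_on_def)
  ultimately show ?thesis
    using \<tau> by (simp add: card_image card_SigmaI finite_walks)
qed

section \<open>Conjugacy classes as orbits\<close>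

lemma conj_class_subset: "\<kappa> \<in> conj_classes G \<Longrightarrow> \<kappa> \<subseteq> carrier G"
  using group_action.orbits_coverture[OF action_by_conjugation]
  by (auto simp: conj_classes_def)

lemma conj_class_nonempty: "\<kappa> \<in> conj_classes G \<Longrightarrow> \<kappa> \<noteq> {}"
  by (auto simp: conj_classes_def orbits_def orbit_def)

lemma conj_class_exists: "a \<in> carrier G \<Longrightarrow> \<exists>\<kappa>\<in>conj_classes G. a \<in> \<kappa>"
  using group_action.orbits_coverture[OF action_by_conjugation]
  by (auto simp: conj_classes_def)

lemma conj_class_unique:
  "\<kappa> \<in> conj_classes G \<Longrightarrow> \<kappa>' \<in> conj_classes G \<Longrightarrow> a \<in> \<kappa> \<Longrightarrow> a \<in> \<kappa>' \<Longrightarrow> \<kappa> = \<kappa>'"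
  using group_action.disjoint_union[OF action_by_conjugation]
  by (auto simp: conj_classes_def)

lemma conj_class_closed:
  assumes "\<kappa> \<in> conj_classes G" "a \<in> \<kappa>" "g \<in> carrier G"
  shows "g \<otimes> a \<otimes> inv g \<in> \<kappa>"
proof -
  obtain x where x: "x \<in> carrier G" and \<kappa>: "\<kappa> = {h \<otimes> x \<otimes> inv h | h. h \<in> carrier G}"
    using assms(1) by (auto simp: conj_classes_def orbits_def orbit_def)
  obtain h where h: "h \<in> carrier G" "a = h \<otimes> x \<otimes> inv h"
    using assms(2) \<kappa> by auto
  have "g \<otimes> a \<otimes> inv g = (g \<otimes> h) \<otimes> x \<otimes> inv (g \<otimes> h)"
    using x h assms(3) by (simp add: m_assoc inv_mult_group)
  then show ?thesis using \<kappa> h assms(3) by blast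
qed

lemma conj_class_conjugate:
  assumes "\<kappa> \<in> conj_classes G" "a \<in> \<kappa>" "b \<in> \<kappa>"
  shows "\<exists>g\<in>carrier G. b = g \<otimes> a \<otimes> inv g"
proof -
  obtain x where x: "x \<in> carrier G" and \<kappa>: "\<kappa> = {h \<otimes> x \<otimes> inv h | h. h \<in> carrier G}"
    using assms(1) by (auto simp: conj_classes_def orbits_def orbit_def)
  obtain h k where h: "h \<in> carrier G" "a = h \<otimes> x \<otimes> inv h"
    and k: "k \<in> carrier G" "b = k \<otimes> x \<otimes> inv k"
    using assms(2,3) \<kappa> by auto
  \<comment> \<open>Once \<open>m_assoc\<close> has moved all brackets to the right,
    \<open>inv h\<close> stands before a longer product; this form of cancellation still applies
    there.\<close>
  have "inv h \<otimes> (h \<otimes> z) = z" if "z \<in> carrier G" for z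
    using h that by (simp add: m_assoc[symmetric])
  then have "b = (k \<otimes> inv h) \<otimes> a \<otimes> inv (k \<otimes> inv h)"
    using x h k by (simp add: m_assoc inv_mult_group)
  then show ?thesis using h k by blast
qed

text \<open>Conjugation by \<open>inv g\<close> is the inverse map. The bijection serves to reindex
  sums over the steps in \<tau>.\<close>

lemma conj_class_bij:
  assumes "\<kappa> \<in> conj_classes G" "g \<in> carrier G"
  shows "bij_betw (\<lambda>t. g \<otimes> t \<otimes> inv g) \<kappa> \<kappa>"
proof (rule bij_betw_byWitness[where f' = "\<lambda>t. inv g \<otimes> t \<otimes> g"])
  have g: "inv g \<otimes> (g \<otimes> z) = z" "g \<otimes> (inv g \<otimes> z) = z" if "z \<in> carrier G" for z
    using assms(2) that by (simp_all add: m_assoc[symmetric])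
  have \<kappa>: "t \<in> carrier G" if "t \<in> \<kappa>" for t
    using that conj_class_subset[OF assms(1)] by blast
  show "\<forall>t\<in>\<kappa>. inv g \<otimes> (g \<otimes> t \<otimes> inv g) \<otimes> g = t" "\<forall>t\<in>\<kappa>. g \<otimes> (inv g \<otimes> t \<otimes> g) \<otimes> inv g = t"
    using assms(2) by (auto simp: m_assoc g \<kappa>)
  show "(\<lambda>t. g \<otimes> t \<otimes> inv g) ` \<kappa> \<subseteq> \<kappa>" "(\<lambda>t. inv g \<otimes> t \<otimes> g) ` \<kappa> \<subseteq> \<kappa>"
    using conj_class_closed[OF assms(1), of _ g] conj_class_closed[OF assms(1), of _ "inv g"]
      assms(2) by auto
qed

section \<open>Walk counts as class functions of the starting point\<close>

text \<open>Conjugating the start and every step by \<open>g\<close> conjugates the endpoint, and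
  both \<tau> and \<nu> are stable under this. The induction does it one step at a time.\<close>

lemma card_walks_conj:
  assumes \<tau>: "\<tau> \<in> conj_classes G" "finite \<tau>" and \<nu>: "\<nu> \<in> conj_classes G" and g: "g \<in> carrier G"
  shows "a \<in> carrier G \<Longrightarrow> card (walks G \<tau> r \<nu> (g \<otimes> a \<otimes> inv g)) = card (walks G \<tau> r \<nu> a)"
proof (induction r arbitrary: a)
  case 0
  have gz: "inv g \<otimes> (g \<otimes> z) = z" if "z \<in> carrier G" for z
    using g that by (simp add: m_assoc[symmetric])
  \<comment> \<open>Conjugating back by \<open>inv g\<close> supplies the converse direction of the
    equivalence below.\<close>
  have "inv g \<otimes> (g \<otimes> a \<otimes> inv g) \<otimes> inv (inv g) = a"
    using g 0 by (simp add: m_assoc gz)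
  then have "g \<otimes> a \<otimes> inv g \<in> \<nu> \<longleftrightarrow> a \<in> \<nu>"
    using conj_class_closed[OF \<nu>, of a g] conj_class_closed[OF \<nu>, of "g \<otimes> a \<otimes> inv g" "inv g"] g
    by auto
  then show ?case using 0 g by (simp add: card_walks_0)
next
  case (Suc r)
  have \<tau>G: "\<tau> \<subseteq> carrier G" by (rule conj_class_subset[OF \<tau>(1)])
  have step: "g \<otimes> a \<otimes> inv g \<otimes> (g \<otimes> t \<otimes> inv g) = g \<otimes> (a \<otimes> t) \<otimes> inv g" if "t \<in> \<tau>" for t
  proof -
    have "t \<in> carrier G" using that \<tau>G by blast
    moreover have "inv g \<otimes> (g \<otimes> z) = z" if "z \<in> carrier G" for z
      using g that by (simp add: m_assoc[symmetric])
    ultimately show ?thesis using g Suc.prems by (simp add: m_assoc)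
  qed
  have "card (walks G \<tau> (Suc r) \<nu> (g \<otimes> a \<otimes> inv g))
      = (\<Sum>t\<in>\<tau>. card (walks G \<tau> r \<nu> (g \<otimes> a \<otimes> inv g \<otimes> t)))"
    using Suc.prems g \<tau>(2) \<tau>G by (simp add: card_walks_Suc)
  also have "\<dots> = (\<Sum>t\<in>\<tau>. card (walks G \<tau> r \<nu> (g \<otimes> (a \<otimes> t) \<otimes> inv g)))"
    using sum.reindex_bij_betw[OF conj_class_bij[OF \<tau>(1) g],
        of "\<lambda>t. card (walks G \<tau> r \<nu> (g \<otimes> a \<otimes> inv g \<otimes> t))"]
    by (simp add: step)
  also have "\<dots> = (\<Sum>t\<in>\<tau>. card (walks G \<tau> r \<nu> (a \<otimes> t)))"
    using Suc.prems \<tau>G by (intro sum.cong Suc.IH) auto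
  also have "\<dots> = card (walks G \<tau> (Suc r) \<nu> a)"
    using Suc.prems \<tau>(2) \<tau>G by (simp add: card_walks_Suc)
  finally show ?case .
qed

section \<open>Homomorphisms as walks\<close>

text \<open>By the universal property of the presentation, a homomorphism is a choice of values on
  the loops subject to the relation. The relation determines the last value from the others, which
  form a start and \<open>r\<close> steps.\<close>

lemma card_bundle_homs:
  assumes fin: "finite \<mu>" "finite \<tau>"
    and sub: "\<mu> \<subseteq> carrier G" "\<tau> \<subseteq> carrier G" "\<nu> \<subseteq> carrier G"
  shows "card (bundle_homs G \<tau> \<mu> \<nu> r) = (\<Sum>a\<in>\<mu>. card (walks G \<tau> r \<nu> a))"
proof -
  \<comment> \<open>\<open>F\<close> records the start and the steps; the value at the last puncture
    is left out because \<open>rel\<close> recovers it.\<close>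
  define F where "F = (\<lambda>\<phi> :: loop_word set \<Rightarrow> 'a.
    (\<phi> (puncture_loop r 0), map (\<lambda>i. \<phi> (puncture_loop r (Suc i))) [0..<r]))"
  have fold: "foldr (\<lambda>i x. g i \<otimes> x) [0..<r + 1] \<one>
      = g 0 \<otimes> foldr (\<otimes>) (map (\<lambda>i. g (Suc i)) [0..<r]) \<one>" for g :: "nat \<Rightarrow> 'a"
  proof -
    have "[0..<r + 1] = 0 # map Suc [0..<r]"
      by (simp del: upt_Suc add: map_Suc_upt upt_conv_Cons)
    then show ?thesis by (simp add: foldr_map comp_def)
  qed
  have rel: "\<phi> (puncture_loop r 0)
        \<otimes> foldr (\<otimes>) (map (\<lambda>i. \<phi> (puncture_loop r (Suc i))) [0..<r]) \<one>
      = \<phi> (puncture_loop r (r + 1))" if "\<phi> \<in> hom (sphere_group r) G" for \<phi>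
    using sphere_group_hom_relation[OF is_group that]
      fold[of "\<lambda>i. \<phi> (puncture_loop r i)"] by simp
  have "bij_betw F (bundle_homs G \<tau> \<mu> \<nu> r) (SIGMA a:\<mu>. walks G \<tau> r \<nu> a)"
    unfolding bij_betw_def
  proof (intro conjI subset_antisym subsetI)
    show "inj_on F (bundle_homs G \<tau> \<mu> \<nu> r)"
    proof (rule inj_onI)
      fix \<phi> \<psi>
      assume \<phi>: "\<phi> \<in> bundle_homs G \<tau> \<mu> \<nu> r" and \<psi>: "\<psi> \<in> bundle_homs G \<tau> \<mu> \<nu> r"
        and eq: "F \<phi> = F \<psi>"
      have hom: "\<phi> \<in> hom (sphere_group r) G" "\<psi> \<in> hom (sphere_group r) G"
        using \<phi> \<psi> by (auto simp: bundle_homs_def)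
      have 0: "\<phi> (puncture_loop r 0) = \<psi> (puncture_loop r 0)"
        using eq by (simp add: F_def)
      have m: "map (\<lambda>i. \<phi> (puncture_loop r (Suc i))) [0..<r]
          = map (\<lambda>i. \<psi> (puncture_loop r (Suc i))) [0..<r]"
        using eq by (simp add: F_def)
      have last: "\<phi> (puncture_loop r (r + 1)) = \<psi> (puncture_loop r (r + 1))"
        using rel[OF hom(1)] rel[OF hom(2)] unfolding 0 m by simp
      have "\<phi> (puncture_loop r i) = \<psi> (puncture_loop r i)" if "i \<le> r + 1" for i
      proof -
        have "i = 0 \<or> (\<exists>j<r. i = Suc j) \<or> i = r + 1"
          using that by (cases i) auto
        then show ?thesis
          using 0 m last by auto
      qed
      then show "\<phi> = \<psi>"
        using \<phi> \<psi> by (intro sphere_group_hom_unique[OF is_group]) (auto simp: bundle_homs_def)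
    qed
  next
    fix p assume "p \<in> F ` bundle_homs G \<tau> \<mu> \<nu> r"
    then obtain \<phi> where \<phi>: "\<phi> \<in> hom (sphere_group r) G" and p: "p = F \<phi>"
      and cl: "\<And>i. i \<le> r + 1 \<Longrightarrow> \<phi> (puncture_loop r i) \<in> puncture_class \<tau> \<mu> \<nu> r i"
      by (auto simp: bundle_homs_def)
    have "\<phi> (puncture_loop r (Suc i)) \<in> \<tau>" if "i < r" for i
      using cl[of "Suc i"] that by (simp add: puncture_class_def)
    then show "p \<in> (SIGMA a:\<mu>. walks G \<tau> r \<nu> a)"
      using cl[of 0] cl[of "r + 1"] rel[OF \<phi>]
      by (auto simp: p F_def walks_def puncture_class_def)
  next
    fix p assume "p \<in> (SIGMA a:\<mu>. walks G \<tau> r \<nu> a)"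
    then obtain a ts where p: "p = (a, ts)" and a: "a \<in> \<mu>" and len: "length ts = r"
      and ts: "set ts \<subseteq> \<tau>" and ends: "a \<otimes> foldr (\<otimes>) ts \<one> \<in> \<nu>"
      by (auto simp: walks_def)
    \<comment> \<open>The inverse of \<open>F\<close> on generators: the value at
      \<open>r + 1\<close> is the one forced by the relation, and the shift \<open>i - 1\<close>
      arises because puncture 0 carries the start, so list position 0 belongs to puncture 1.\<close>
    define g where "g = (\<lambda>i. if i = 0 then a else if i = r + 1 then a \<otimes> foldr (\<otimes>) ts \<one>
      else ts ! (i - 1))"
    have g_class: "g i \<in> puncture_class \<tau> \<mu> \<nu> r i" if "i \<le> r + 1" for i
    proof -
      have "ts ! (i - 1) \<in> \<tau>" if "i \<noteq> 0" "i \<noteq> r + 1"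
        using that \<open>i \<le> r + 1\<close> len ts by (intro subsetD[OF ts] nth_mem) auto
      then show ?thesis using a ends by (simp add: g_def puncture_class_def)
    qed
    have g_closed: "g i \<in> carrier G" if "i \<le> r + 1" for i
      using that sub g_class[OF that] by (auto simp: puncture_class_def split: if_splits)
    have g_ts: "map (\<lambda>i. g (Suc i)) [0..<r] = ts"
      using len by (intro nth_equalityI) (auto simp: g_def)
    have "foldr (\<lambda>i x. g i \<otimes> x) [0..<r + 1] \<one> = g (r + 1)"
      unfolding fold g_ts by (simp add: g_def)
    from sphere_group_hom_exists[OF is_group g_closed this]
    obtain \<phi> where \<phi>: "\<phi> \<in> hom (sphere_group r) G \<inter> extensional (carrier (sphere_group r))"
      and \<phi>g: "\<And>i. i \<le> r + 1 \<Longrightarrow> \<phi> (puncture_loop r i) = g i"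
      by blast
    have "\<phi> \<in> bundle_homs G \<tau> \<mu> \<nu> r"
      using \<phi> \<phi>g g_class by (auto simp: bundle_homs_def)
    moreover have "map (\<lambda>i. \<phi> (puncture_loop r (Suc i))) [0..<r] = ts"
      unfolding g_ts[symmetric] by (rule map_cong) (auto simp: \<phi>g)
    then have "F \<phi> = p"
      using \<phi>g[of 0] by (simp add: F_def p g_def)
    ultimately show "p \<in> F ` bundle_homs G \<tau> \<mu> \<nu> r" by blast
  qed
  then show ?thesis
    using fin by (simp add: bij_betw_same_card card_SigmaI finite_walks)
qed

end

section \<open>Cutting walks in a finite group\<close>

locale finite_group = group +
  assumes finite_carrier: "finite (carrier G)"
begin

lemma finite_conj_class: "\<kappa> \<in> conj_classes G \<Longrightarrow> finite \<kappa>"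
  using conj_class_subset finite_carrier finite_subset by blast

lemma finite_conj_classes: "finite (conj_classes G)"
  using finite_carrier by (simp add: conj_classes_def orbits_def)

text \<open>Any two points of \<kappa> are conjugate and hence have equally many walks, so the sum
  in \<open>card_bundle_homs\<close> consists of \<open>card \<kappa>\<close> equal terms.\<close>

lemma card_walks_eq_bundle_homs:
  assumes \<tau>: "\<tau> \<in> conj_classes G" and \<nu>: "\<nu> \<in> conj_classes G"
    and \<kappa>: "\<kappa> \<in> conj_classes G" and a: "a \<in> \<kappa>"
  shows "of_nat (card (walks G \<tau> r \<nu> a))
    = (of_nat (card (bundle_homs G \<tau> \<kappa> \<nu> r)) / of_nat (card \<kappa>) :: complex)"
proof -
  have "card (walks G \<tau> r \<nu> b) = card (walks G \<tau> r \<nu> a)" if b: "b \<in> \<kappa>" for b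
  proof -
    obtain g where "g \<in> carrier G" "b = g \<otimes> a \<otimes> inv g"
      using conj_class_conjugate[OF \<kappa> a b] by blast
    moreover have "a \<in> carrier G" using a conj_class_subset[OF \<kappa>] by blast
    ultimately show ?thesis
      using card_walks_conj[OF \<tau> finite_conj_class[OF \<tau>] \<nu>] by simp
  qed
  then have "card (bundle_homs G \<tau> \<kappa> \<nu> r) = card \<kappa> * card (walks G \<tau> r \<nu> a)"
    using \<kappa> \<tau> \<nu> by (simp add: card_bundle_homs finite_conj_class conj_class_subset)
  moreover have "card \<kappa> \<noteq> 0"
    using a finite_conj_class[OF \<kappa>] by auto
  ultimately show ?thesis by simp
qed

text \<open>A Chapman-Kolmogorov identity: \<kappa> is the class reached after \<open>k\<close>
  steps, and the quotient counts the continuations from any one point of \<kappa>. The start must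
  vary in the induction, since the first step moves it.\<close>

lemma card_walks_add:
  assumes \<tau>: "\<tau> \<in> conj_classes G" and \<nu>: "\<nu> \<in> conj_classes G"
  shows "a \<in> carrier G \<Longrightarrow> of_nat (card (walks G \<tau> (k + l) \<nu> a)) =
    (\<Sum>\<kappa>\<in>conj_classes G. of_nat (card (walks G \<tau> k \<kappa> a)) *
       (of_nat (card (bundle_homs G \<tau> \<kappa> \<nu> l)) / of_nat (card \<kappa>)) :: complex)"
proof (induction k arbitrary: a)
  case 0
  let ?q = "\<lambda>\<kappa>. of_nat (card (bundle_homs G \<tau> \<kappa> \<nu> l)) / of_nat (card \<kappa>) :: complex"
  obtain \<kappa> where \<kappa>: "\<kappa> \<in> conj_classes G" "a \<in> \<kappa>"
    using conj_class_exists[OF 0] by blast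
  \<comment> \<open>A walk without steps stays at \<open>a\<close>, so only the class of
    \<open>a\<close> contributes.\<close>
  have "(\<Sum>\<kappa>'\<in>conj_classes G. of_nat (card (walks G \<tau> 0 \<kappa>' a)) * ?q \<kappa>')
      = (\<Sum>\<kappa>'\<in>conj_classes G. if \<kappa>' = \<kappa> then ?q \<kappa> else 0)"
    using \<kappa> conj_class_unique by (intro sum.cong) (auto simp: card_walks_0[OF 0])
  also have "\<dots> = of_nat (card (walks G \<tau> l \<nu> a))"
    using finite_conj_classes \<kappa> card_walks_eq_bundle_homs[OF \<tau> \<nu> \<kappa>] by simp
  finally show ?case by simp
next
  case (Suc k)
  let ?q = "\<lambda>\<kappa>. of_nat (card (bundle_homs G \<tau> \<kappa> \<nu> l)) / of_nat (card \<kappa>) :: complex"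
  have \<tau>G: "\<tau> \<subseteq> carrier G" "finite \<tau>"
    using conj_class_subset finite_conj_class \<tau> by auto
  have "of_nat (card (walks G \<tau> (Suc k + l) \<nu> a))
      = (\<Sum>t\<in>\<tau>. of_nat (card (walks G \<tau> (k + l) \<nu> (a \<otimes> t))) :: complex)"
    using Suc.prems \<tau>G by (simp add: card_walks_Suc)
  also have "\<dots> = (\<Sum>t\<in>\<tau>. \<Sum>\<kappa>\<in>conj_classes G. of_nat (card (walks G \<tau> k \<kappa> (a \<otimes> t))) * ?q \<kappa>)"
    using Suc.prems \<tau>G by (intro sum.cong Suc.IH) auto
  also have "\<dots> = (\<Sum>\<kappa>\<in>conj_classes G. \<Sum>t\<in>\<tau>. of_nat (card (walks G \<tau> k \<kappa> (a \<otimes> t))) * ?q \<kappa>)"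
    by (rule sum.swap)
  also have "\<dots> = (\<Sum>\<kappa>\<in>conj_classes G. of_nat (card (walks G \<tau> (Suc k) \<kappa> a)) * ?q \<kappa>)"
    using Suc.prems \<tau>G by (simp only: card_walks_Suc of_nat_sum sum_distrib_right)
  finally show ?case .
qed

text \<open>Summing the cut identity over the starting points in \<mu> turns the walk counts of the
  first piece into numbers of homomorphisms.\<close>

lemma card_bundle_homs_add:
  assumes \<mu>: "\<mu> \<in> conj_classes G" and \<tau>: "\<tau> \<in> conj_classes G" and \<nu>: "\<nu> \<in> conj_classes G"
  shows "of_nat (card (bundle_homs G \<tau> \<mu> \<nu> (k + l))) =
    (\<Sum>\<kappa>\<in>conj_classes G. of_nat (card (bundle_homs G \<tau> \<mu> \<kappa> k)) *
       of_nat (card (bundle_homs G \<tau> \<kappa> \<nu> l)) / of_nat (card \<kappa>) :: complex)"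
proof -
  let ?q = "\<lambda>\<kappa>. of_nat (card (bundle_homs G \<tau> \<kappa> \<nu> l)) / of_nat (card \<kappa>) :: complex"
  have homs: "of_nat (card (bundle_homs G \<tau> \<mu> \<kappa> r))
      = (\<Sum>a\<in>\<mu>. of_nat (card (walks G \<tau> r \<kappa> a)) :: complex)" if "\<kappa> \<in> conj_classes G" for \<kappa> r
    using that \<mu> \<tau> by (simp add: card_bundle_homs finite_conj_class conj_class_subset)
  have "of_nat (card (bundle_homs G \<tau> \<mu> \<nu> (k + l)))
      = (\<Sum>a\<in>\<mu>. \<Sum>\<kappa>\<in>conj_classes G. of_nat (card (walks G \<tau> k \<kappa> a)) * ?q \<kappa>)"
    unfolding homs[OF \<nu>] using conj_class_subset[OF \<mu>]
    by (intro sum.cong card_walks_add[OF \<tau> \<nu>]) auto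
  also have "\<dots> = (\<Sum>\<kappa>\<in>conj_classes G. \<Sum>a\<in>\<mu>. of_nat (card (walks G \<tau> k \<kappa> a)) * ?q \<kappa>)"
    by (rule sum.swap)
  also have "\<dots> = (\<Sum>\<kappa>\<in>conj_classes G. of_nat (card (bundle_homs G \<tau> \<mu> \<kappa> k)) * ?q \<kappa>)"
    by (intro sum.cong) (simp_all only: homs sum_distrib_right)
  finally show ?thesis by simp
qed

section \<open>The trace in the denominator\<close>

text \<open>At the unit, the convolution sums over \<open>y\<close> the product of two indicators,
  and both express that \<open>inv y\<close> lies in \<kappa>.\<close>

lemma class_trace_convol_inverse:
  assumes \<kappa>: "\<kappa> \<in> conj_classes G"
  shows "class_trace G (convol G (class_fun (set_inv \<kappa>)) (class_fun \<kappa>)) = of_nat (card \<kappa>)"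
proof -
  have \<kappa>G: "\<kappa> \<subseteq> carrier G" by (rule conj_class_subset[OF \<kappa>])
  have "y \<in> set_inv \<kappa> \<longleftrightarrow> inv y \<in> \<kappa>" if "y \<in> carrier G" for y
    using that \<kappa>G by (force simp: SET_INV_def)
  then have "class_trace G (convol G (class_fun (set_inv \<kappa>)) (class_fun \<kappa>))
      = (\<Sum>y\<in>carrier G. of_bool (inv y \<in> \<kappa>))"
    by (auto simp: class_trace_def convol_def class_fun_def intro!: sum.cong)
  \<comment> \<open>Inversion permutes the group.\<close>
  also have "\<dots> = (\<Sum>y\<in>carrier G. of_bool (y \<in> \<kappa>))"
    by (rule sum.reindex_bij_witness[of _ "\<lambda>y. inv y" "\<lambda>y. inv y"]) auto
  also have "\<dots> = of_nat (card (carrier G \<inter> \<kappa>))"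
    using finite_carrier by (simp add: of_bool_def sum.If_cases)
  finally show ?thesis using \<kappa>G by (simp add: Int_absorb1)
qed

end

section \<open>Comparison of coefficients\<close>

theorem theorem5p6:
  fixes G :: "('a, 'm) monoid_scheme" and \<mu> \<nu> \<tau> :: "'a set"
  assumes "group G" and "finite (carrier G)"
    and "\<mu> \<in> conj_classes G" and "\<nu> \<in> conj_classes G" and "\<tau> \<in> conj_classes G"
  shows "bundle_gf G \<tau> \<mu> \<nu> + fps_X * fps_deriv (bundle_gf G \<tau> \<mu> \<nu>) =
    fps_const (of_nat (order G)) *
      (\<Sum>\<kappa>\<in>conj_classes G. bundle_gf G \<tau> \<mu> \<kappa> * bundle_gf G \<tau> \<kappa> \<nu> /
         fps_const (class_trace G (convol G (class_fun (set_inv\<^bsub>G\<^esub> \<kappa>)) (class_fun \<kappa>))))"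
proof (rule fps_ext)
  fix r
  interpret finite_group G
    using assms(1,2) by (simp add: finite_group_def finite_group_axioms_def)
  let ?n = "of_nat (order G) :: complex"
  let ?h = "bundle_number G \<tau>"
  have n: "?n \<noteq> 0"
    using finite_carrier by (auto simp: order_def)
  \<comment> \<open>Each bundle number is a number of homomorphisms divided by \<open>?n\<close>.
    The product on the right has two such divisions and the left side one, which leaves a single
    factor \<open>?n\<close>.\<close>
  have split: "?h \<mu> \<nu> r = ?n * (\<Sum>\<kappa>\<in>conj_classes G. ?h \<mu> \<kappa> k * ?h \<kappa> \<nu> (r - k) / of_nat (card \<kappa>))"
    if "k \<le> r" for k
    using card_bundle_homs_add[OF assms(3,5,4), of k "r - k"] that n
    by (simp add: bundle_number_def sum_distrib_left sum_divide_distrib field_simps)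
  have divide: "fps_nth (A / fps_const c) r = fps_nth A r / c" if "c \<noteq> 0" for A :: "complex fps" and c
    using that by (simp add: fps_divide_unit fps_const_inverse divide_inverse)
  have card_pos: "of_nat (card \<kappa>) \<noteq> (0 :: complex)" if "\<kappa> \<in> conj_classes G" for \<kappa>
    using that finite_conj_class[OF that] conj_class_nonempty[OF that] by simp
  \<comment> \<open>The operator multiplies the coefficient at \<open>r\<close> by
    \<open>r + 1\<close>, written here as a constant sum with one term for each cutting place
    \<open>k\<close>. The case split on \<open>r\<close> is due to the index shift by
    \<open>fps_X\<close>.\<close>
  have "fps_nth (bundle_gf G \<tau> \<mu> \<nu> + fps_X * fps_deriv (bundle_gf G \<tau> \<mu> \<nu>)) r
      = (\<Sum>k=0..r. ?h \<mu> \<nu> r)"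
    by (cases r) (simp_all add: bundle_gf_def algebra_simps)
  also have "\<dots> = (\<Sum>k=0..r. ?n * (\<Sum>\<kappa>\<in>conj_classes G. ?h \<mu> \<kappa> k * ?h \<kappa> \<nu> (r - k) / of_nat (card \<kappa>)))"
    by (intro sum.cong split) auto
  \<comment> \<open>With the sum over \<open>k\<close> innermost, each class contributes a Cauchy
    product coefficient.\<close>
  also have "\<dots> = ?n * (\<Sum>\<kappa>\<in>conj_classes G. (\<Sum>k=0..r. ?h \<mu> \<kappa> k * ?h \<kappa> \<nu> (r - k)) / of_nat (card \<kappa>))"
    by (simp only: sum_distrib_left[symmetric] sum_divide_distrib) (rule arg_cong[OF sum.swap])
  also have "\<dots> = ?n * (\<Sum>\<kappa>\<in>conj_classes G. fps_nth (bundle_gf G \<tau> \<mu> \<kappa> * bundle_gf G \<tau> \<kappa> \<nu> /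
      fps_const (of_nat (card \<kappa>))) r)"
    by (intro arg_cong[where f = "(*) ?n"] sum.cong)
       (simp_all only: divide[OF card_pos] fps_mult_nth bundle_gf_def fps_nth_Abs_fps)
  also have "\<dots> = fps_nth (fps_const ?n * (\<Sum>\<kappa>\<in>conj_classes G. bundle_gf G \<tau> \<mu> \<kappa> * bundle_gf G \<tau> \<kappa> \<nu> /
         fps_const (class_trace G (convol G (class_fun (set_inv\<^bsub>G\<^esub> \<kappa>)) (class_fun \<kappa>))))) r"
    by (simp add: class_trace_convol_inverse fps_sum_nth)
  finally show "fps_nth (bundle_gf G \<tau> \<mu> \<nu> + fps_X * fps_deriv (bundle_gf G \<tau> \<mu> \<nu>)) r = \<dots>" .
qed

end
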